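(* Let $a,b$ be integers with $1<a\le b$. For all $f,g\in\mathcal A$, \begin{align*} D_q^a[f]\,D_q^b[g] &=\sum_{j=0}^{a}\sum_{i=1}^{b-j}(-1)^j\binom{a+b-1-i-j}{a-1}\binom{a}{j}D_q^j\big[f\,D_q^i[g]\big]\\ &\quad+\sum_{j=0}^{b}\sum_{i=1}^{\max(1,a-j)}(-1)^j\binom{a+b-1-i-j}{b-1}\binom{b}{j}D_q^j\big[D_q^i[f]\,g\big]\\ &\quad+\sum_{j=1}^{a}(-1)^j\binom{a+b-1-j}{j-1,\;a-j,\;b-j}D_q^j[fg]. \end{align*}
   Context: $\mathcal A=t\,\mathbb Q[[t,q]]$ is the (non-unital, commutative) algebra of formal power series in $t,q$ with strictly positive valuation in $t$. The $q$-dilation operator is $E_q[f](t)=f(qt)$ and the $q$-difference operator is the $\mathbb Q[[q]]$-linear map $D_q=I-E_q:\mathcal A\to\mathcal A$, i.e. $D_q[f](t)=f(t)-f(qt)$. $D_q^n$ denotes the $n$-fold composition, $D_q^0=I$. For non-negative integers $x,y,z$ with $x+y+z=N$, $\binom{N}{x,y,z}=\frac{N!}{x!\,y!\,z!}$. A binomial coefficient $\binom{N}{m}$ with $0\le N<m$ is $0$. Empty sums (upper limit smaller than lower limit) are $0$. *)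

theory Defs
  imports "HOL-Computational_Algebra.Formal_Power_Series"
begin

text \<open>
  The ring \<open>\<rat>[[t,q]]\<close> is rendered as \<open>(\<rat>[[q]])[[t]]\<close>: the outer series is in \<open>t\<close>,
  its coefficients are series in \<open>q\<close>.  So \<open>t\<close> is \<open>fps_X\<close> and \<open>q\<close> is \<open>fps_const fps_X\<close>.
\<close>

type_synonym tq_series = "rat fps fps"

definition t_var :: tq_series where
  "t_var = fps_X"

definition q_var :: tq_series where
  "q_var = fps_const fps_X"

definition \<A> :: "tq_series set" where
  "\<A> = {t_var * h | h. True}"

definition E_q :: "tq_series \<Rightarrow> tq_series" where
  "E_q f = fps_compose f (q_var * t_var)"

definition D_q :: "tq_series \<Rightarrow> tq_series" where
  "D_q f = f - E_q f"

text \<open>Meaningful for \<open>x + y + z = N\<close>, in which case the division is exact.\<close>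

definition trinomial :: "nat \<Rightarrow> nat \<Rightarrow> nat \<Rightarrow> nat \<Rightarrow> nat" where
  "trinomial N x y z = fact N div (fact x * fact y * fact z)"

lemma mem_A_iff: "f \<in> \<A> \<longleftrightarrow> fps_nth f 0 = 0"
proof
  assume "fps_nth f 0 = 0"
  then have "f = t_var * fps_shift 1 f"
    by (intro fps_ext) (auto simp: t_var_def)
  then show "f \<in> \<A>" by (auto simp: \<A>_def)
qed (auto simp: \<A>_def t_var_def)

lemma E_q_nth: "fps_nth (E_q f) n = fps_X ^ n * fps_nth f n"
  by (simp add: E_q_def q_var_def t_var_def fps_compose_linear)

lemma D_q_mem_A: "f \<in> \<A> \<Longrightarrow> D_q f \<in> \<A>"
  by (simp add: mem_A_iff D_q_def E_q_nth)

end

theory Submission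
  imports Defs
begin

text \<open>
  Since \<open>E_q\<close> is a ring homomorphism, \<open>D_q\<close> obeys
  \<open>D (x y) = D x \<cdot> y + x \<cdot> D y - D x \<cdot> D y\<close>.  Applied to \<open>x = D\<^sup>a f\<close> and \<open>y = D\<^sup>b g\<close>, this is the recursion
  \<open>F (a+1) (b+1) = F (a+1) b + F a (b+1) - D (F a b)\<close> for \<open>F a b = D\<^sup>a f \<cdot> D\<^sup>b g\<close>.
  By Pascal's rule each of the three sums on the right-hand side satisfies the same recursion,
  and so it suffices to compare the two sides for \<open>a = 0\<close> and for \<open>b = 0\<close>.  The coefficients are
  extended by zero outside of the summation range, and to the boundary values of \<open>a\<close> and \<open>b\<close>.
\<close>

text \<open>
  For \<open>a > 0\<close> the first binomial coefficient is \<open>a+b-1-i-j\<close> over \<open>a-1\<close>; the form chosen here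
  also gives the right value (1 if \<open>i + j = b\<close>, else 0) for \<open>a = 0\<close>.
\<close>

definition pair_coeff :: "nat \<Rightarrow> nat \<Rightarrow> nat \<Rightarrow> nat \<Rightarrow> nat" where
  "pair_coeff i a b j =
    (if i + j \<le> b then ((a + (b - i - j) - 1) choose (b - i - j)) * (a choose j) else 0)"

text \<open>For \<open>1 \<le> j\<close>, \<open>j \<le> a\<close> and \<open>j \<le> b\<close> this
  is the trinomial coefficient as a product of binomials. The value 1 at
  \<open>a = b = j = 0\<close> supplies the boundary term \<open>f * g\<close>.\<close>

definition diag_coeff :: "nat \<Rightarrow> nat \<Rightarrow> nat \<Rightarrow> nat" where
  "diag_coeff a b j =
    (if j = 0 then of_bool (a = 0 \<and> b = 0)
     else if j \<le> a \<and> j \<le> b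
       then ((a + b - 1 - j) choose (j - 1)) * ((a + b - 2 * j) choose (a - j))
     else 0)"

text \<open>In the recursion for \<open>F\<close>, passing from \<open>j\<close> to
  \<open>Suc j\<close> under \<open>- D\<close> flips the sign \<open>(-1) ^ j\<close>; hence the
  plus before \<open>c a b j\<close>.\<close>

definition pascal_rec :: "(nat \<Rightarrow> nat \<Rightarrow> nat \<Rightarrow> nat) \<Rightarrow> bool" where
  "pascal_rec c \<longleftrightarrow>
    (\<forall>a b j. a < j \<longrightarrow> c a b j = 0) \<and>
    (\<forall>a b. c (Suc a) (Suc b) 0 = c (Suc a) b 0 + c a (Suc b) 0) \<and>
    (\<forall>a b j. c (Suc a) (Suc b) (Suc j) = c (Suc a) b (Suc j) + c a (Suc b) (Suc j) + c a b j)"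

lemma pascal_rec_pair_coeff: "pascal_rec (pair_coeff i)"
  unfolding pascal_rec_def
proof (intro conjI allI impI)
  fix a b j :: nat
  show "pair_coeff i a b j = 0" if "a < j"
    using that by (simp add: pair_coeff_def)
  show "pair_coeff i (Suc a) (Suc b) 0 = pair_coeff i (Suc a) b 0 + pair_coeff i a (Suc b) 0"
  proof (cases "i \<le> b")
    case True
    then obtain n where "b = i + n" by (auto simp: le_iff_add)
    then show ?thesis by (simp add: pair_coeff_def Suc_diff_le)
  next
    case False
    then show ?thesis by (auto simp: pair_coeff_def)
  qed
  show "pair_coeff i (Suc a) (Suc b) (Suc j) =
      pair_coeff i (Suc a) b (Suc j) + pair_coeff i a (Suc b) (Suc j) + pair_coeff i a b j"
  proof -
    \<comment> \<open>At \<open>b = i + j\<close> the first summand is out of range, leaving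
      Pascal's rule for \<open>Suc a choose Suc j\<close>. Beyond, that rule merges the last two
      summands, and Pascal's rule in the other factor finishes.\<close>
    consider "b < i + j" | "b = i + j" | n where "b = Suc (i + j + n)"
      by (metis add_Suc_right less_imp_Suc_add linorder_neqE_nat)
    then show ?thesis
    proof cases
      case 3
      have "b - i - j = Suc n" "b - i - Suc j = n" "Suc b - i - Suc j = Suc n"
        using 3 by auto
      then show ?thesis
        using 3 by (simp add: pair_coeff_def algebra_simps)
    qed (auto simp: pair_coeff_def)
  qed
qed

lemma trinomial_eq_choose:
  "trinomial (x + y + z) x y z = ((x + y + z) choose x) * ((y + z) choose y)"
proof -
  have "fact (x + y + z) = fact x * fact (y + z) * ((x + y + z) choose x)"
    using binomial_fact_lemma[of x "x + y + z"] by (simp add: add.assoc)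
  also have "fact (y + z) = fact y * fact z * ((y + z) choose y)"
    using binomial_fact_lemma[of y "y + z"] by simp
  finally have "fact (x + y + z) =
      ((x + y + z) choose x) * ((y + z) choose y) * (fact x * fact y * fact z :: nat)"
    by (simp only: mult_ac)
  then show ?thesis
    by (simp add: trinomial_def)
qed

lemma diag_coeff_shift:
  "diag_coeff (Suc (x + y)) (Suc (x + z)) (Suc x) = ((x + y + z) choose x) * ((y + z) choose y)"
proof -
  have "Suc (x + y) + Suc (x + z) - 1 - Suc x = x + y + z"
    "Suc (x + y) + Suc (x + z) - 2 * Suc x = y + z"
    by simp_all
  then show ?thesis by (simp add: diag_coeff_def add_ac)
qed

text \<open>Pascal's rule for trinomials: the three summands lower \<open>b - j\<close>,
  \<open>a - j\<close> and \<open>j - 1\<close> respectively.\<close>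

lemma pascal_rec_diag_coeff: "pascal_rec diag_coeff"
  unfolding pascal_rec_def
proof (intro conjI allI impI)
  fix a b j :: nat
  show "diag_coeff a b j = 0" if "a < j"
    using that by (simp add: diag_coeff_def)
  show "diag_coeff (Suc a) (Suc b) 0 = diag_coeff (Suc a) b 0 + diag_coeff a (Suc b) 0"
    by (simp add: diag_coeff_def)
  show "diag_coeff (Suc a) (Suc b) (Suc j) =
      diag_coeff (Suc a) b (Suc j) + diag_coeff a (Suc b) (Suc j) + diag_coeff a b j"
  proof (cases "j \<le> a \<and> j \<le> b")
    case True
    then obtain y z where yz: "a = j + y" "b = j + z" by (auto simp: le_iff_add)
    have lhs: "diag_coeff (Suc a) (Suc b) (Suc j) = ((j + y + z) choose j) * ((y + z) choose y)"
      using yz diag_coeff_shift by simp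
    have left: "diag_coeff (Suc a) b (Suc j) =
        (case z of 0 \<Rightarrow> 0 | Suc z' \<Rightarrow> ((j + y + z') choose j) * ((y + z') choose y))"
      using yz diag_coeff_shift[of j y "z - 1"] by (cases z) (simp_all add: diag_coeff_def[of _ j])
    have right: "diag_coeff a (Suc b) (Suc j) =
        (case y of 0 \<Rightarrow> 0 | Suc y' \<Rightarrow> ((j + y' + z) choose j) * ((y' + z) choose y'))"
      using yz diag_coeff_shift[of j "y - 1" z] by (cases y) (simp_all add: diag_coeff_def[of j])
    show ?thesis
    \<comment> \<open>For \<open>j = 0\<close> the last summand is 1 exactly if
      \<open>y = z = 0\<close>, where the other two vanish; otherwise this is the ordinary Pascal
      rule.\<close>
    proof (cases j)
      case 0
      then show ?thesis
        using yz unfolding lhs left right by (cases y; cases z) (simp_all add: diag_coeff_def[of _ _ 0])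
    next
      case (Suc x)
      have "diag_coeff a b j = ((x + y + z) choose x) * ((y + z) choose y)"
        using yz Suc diag_coeff_shift by simp
      then show ?thesis
        using Suc unfolding lhs left right by (cases y; cases z) (simp_all add: algebra_simps)
    qed
  qed (auto simp: diag_coeff_def)
qed

text \<open>With \<open>E = I - D\<close>, the axiom \<open>mult\<close> says that \<open>E\<close>
  is multiplicative.\<close>

locale q_difference =
  fixes D :: "'a::comm_ring_1 \<Rightarrow> 'a"
  assumes add: "D (x + y) = D x + D y"
    and mult: "D (x * y) = D x * y + x * D y - D x * D y"
begin

lemma zero: "D 0 = 0"
  using add[of 0 0] by simp

lemma minus: "D (- x) = - D x"
  using add[of x "- x"] by (simp add: zero add_eq_0_iff)

lemma of_nat_mult: "D (of_nat n * x) = of_nat n * D x"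
  by (induction n) (simp_all add: zero add algebra_simps)

lemma signed_mult: "D ((-1) ^ j * of_nat n * x) = (-1) ^ j * of_nat n * D x"
  by (cases "even j") (simp_all add: minus of_nat_mult)

lemma sum: "D (\<Sum>j\<in>S. h j) = (\<Sum>j\<in>S. D (h j))"
  by (induction S rule: infinite_finite_induct) (simp_all add: zero add)

definition alt_sum :: "(nat \<Rightarrow> nat \<Rightarrow> nat \<Rightarrow> nat) \<Rightarrow> 'a \<Rightarrow> nat \<Rightarrow> nat \<Rightarrow> 'a" where
  "alt_sum c x a b = (\<Sum>j\<le>a. (-1) ^ j * of_nat (c a b j) * (D ^^ j) x)"

lemma alt_sum_rec:
  assumes "pascal_rec c"
  shows "alt_sum c x (Suc a) (Suc b) =
    alt_sum c x (Suc a) b + alt_sum c x a (Suc b) - D (alt_sum c x a b)"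
proof -
  have c: "c a (Suc b) (Suc a) = 0"
      "c (Suc a) (Suc b) 0 = c (Suc a) b 0 + c a (Suc b) 0"
      "c (Suc a) (Suc b) (Suc j) = c (Suc a) b (Suc j) + c a (Suc b) (Suc j) + c a b j" for j
    using assms by (auto simp: pascal_rec_def)
  \<comment> \<open>A zero term extends the range to \<open>Suc a\<close>, matching the other
    sums.\<close>
  have 1: "alt_sum c x a (Suc b) = (\<Sum>j\<le>Suc a. (-1) ^ j * of_nat (c a (Suc b) j) * (D ^^ j) x)"
    by (simp add: alt_sum_def c(1))
  have 2: "D (alt_sum c x a b) = (\<Sum>j\<le>a. (-1) ^ j * of_nat (c a b j) * (D ^^ Suc j) x)"
    by (simp add: alt_sum_def sum signed_mult)
  show ?thesis
    unfolding 1 2 unfolding alt_sum_def sum.atMost_Suc_shift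
    by (simp add: c(2,3) algebra_simps sum.distrib sum_negf sum_subtractf)
qed

lemma D_pow_mult_rec:
  "(D ^^ Suc a) f * (D ^^ Suc b) g =
    (D ^^ Suc a) f * (D ^^ b) g + (D ^^ a) f * (D ^^ Suc b) g - D ((D ^^ a) f * (D ^^ b) g)"
  by (simp add: mult)

text \<open>Only \<open>j = 0\<close> remains, and \<open>(n - 1) choose n\<close> with
  \<open>n = b - i\<close> is 1 for \<open>n = 0\<close> (truncated subtraction) and 0 otherwise.
  For \<open>b = 0\<close> the index \<open>i = b\<close> lies outside the range.\<close>

lemma alt_sum_pair_left_0:
  assumes "b \<le> N"
  shows "(\<Sum>i=1..N. alt_sum (pair_coeff i) (f * (D ^^ i) g) 0 b) = of_bool (b > 0) * (f * (D ^^ b) g)"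
proof -
  have "alt_sum (pair_coeff i) (f * (D ^^ i) g) 0 b = (if i = b then f * (D ^^ b) g else 0)" for i
    by (auto simp: alt_sum_def pair_coeff_def binomial_eq_0)
  then show ?thesis
    using assms by (auto simp: sum.delta)
qed

lemma alt_sum_pair_right_0:
  "(\<Sum>i=1..N. alt_sum (pair_coeff i) (h i) a 0) = 0"
  by (simp add: alt_sum_def pair_coeff_def)

lemma alt_sum_diag_left_0: "alt_sum diag_coeff x 0 b = of_bool (b = 0) * x"
  by (simp add: alt_sum_def diag_coeff_def)

lemma alt_sum_diag_right_0: "alt_sum diag_coeff x a 0 = of_bool (a = 0) * x"
proof -
  have "alt_sum diag_coeff x a 0 = (\<Sum>j\<le>a. if j = 0 then of_bool (a = 0) * x else 0)"
    unfolding alt_sum_def by (intro sum.cong) (auto simp: diag_coeff_def)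
  then show ?thesis by (simp add: sum.delta)
qed

text \<open>The fixed bound \<open>N\<close> keeps the range of \<open>i\<close> constant during the induction.\<close>

lemma D_pow_mult_D_pow:
  assumes "a \<le> N" "b \<le> N"
  shows "(D ^^ a) f * (D ^^ b) g =
      (\<Sum>i=1..N. alt_sum (pair_coeff i) (f * (D ^^ i) g) a b)
    + (\<Sum>i=1..N. alt_sum (pair_coeff i) ((D ^^ i) f * g) b a)
    + alt_sum diag_coeff (f * g) a b"
  using assms
proof (induction a arbitrary: b)
  case 0
  then show ?case
    by (simp only: alt_sum_pair_left_0 alt_sum_pair_right_0 alt_sum_diag_left_0) simp
next
  case (Suc a)
  note outer = Suc
  from \<open>b \<le> N\<close> show ?case
  proof (induction b)
    case 0
    have "(\<Sum>i=1..N. alt_sum (pair_coeff i) ((D ^^ i) f * g) 0 (Suc a)) = (D ^^ Suc a) f * g"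
      using alt_sum_pair_left_0[OF \<open>Suc a \<le> N\<close>, of g f] by (simp add: mult.commute)
    then show ?case
      by (simp only: alt_sum_pair_right_0 alt_sum_diag_right_0) simp
  next
    case (Suc b)
    have le: "a \<le> N" "b \<le> N" "Suc b \<le> N"
      using outer(2) Suc.prems by simp_all
    \<comment> \<open>The instances at \<open>(Suc a, b)\<close>, \<open>(a, Suc b)\<close> and
      \<open>(a, b)\<close>. The recursion is symmetric in its first two terms, so the sum with
      \<open>b\<close> and \<open>a\<close> exchanged obeys it too.\<close>
    note IH = Suc.IH[OF le(2)] outer(1)[OF le(1) le(3)] outer(1)[OF le(1) le(2)]
    show ?case
      unfolding D_pow_mult_rec[of a f b g] unfolding IH add sum
      by (simp add: alt_sum_rec[OF pascal_rec_pair_coeff] alt_sum_rec[OF pascal_rec_diag_coeff]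
          sum.distrib sum_subtractf algebra_simps)
  qed
qed

end

interpretation D_q: q_difference D_q
proof
  fix x y
  show "D_q (x + y) = D_q x + D_q y"
    by (simp add: D_q_def E_q_def fps_compose_add_distrib)
  have "E_q (x * y) = E_q x * E_q y"
    by (simp add: E_q_def q_var_def t_var_def fps_compose_mult_distrib)
  then show "D_q (x * y) = D_q x * y + x * D_q y - D_q x * D_q y"
    by (simp add: D_q_def algebra_simps)
qed

lemma pair_coeff_eq:
  assumes "0 < a" "i + j \<le> b"
  shows "pair_coeff i a b j = ((a + b - 1 - i - j) choose (a - 1)) * (a choose j)"
proof -
  obtain n where n: "b = i + j + n" using assms(2) by (auto simp: le_iff_add)
  have "((a + n - 1) choose n) = ((a + n - 1) choose (a - 1))"
    using assms(1) binomial_symmetric[of n "a + n - 1"] by simp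
  moreover have "b - i - j = n" "a + b - 1 - i - j = a + n - 1"
    using n assms(1) by simp_all
  ultimately show ?thesis
    using assms(2) by (simp add: pair_coeff_def)
qed

lemma diag_coeff_eq_trinomial:
  assumes "0 < j" "j \<le> a" "j \<le> b"
  shows "diag_coeff a b j = trinomial (a + b - 1 - j) (j - 1) (a - j) (b - j)"
proof -
  obtain y z where "a = j + y" "b = j + z"
    using assms by (auto simp: le_iff_add)
  moreover obtain x where "j = Suc x"
    using assms(1) gr0_implies_Suc by blast
  ultimately show ?thesis
    using trinomial_eq_choose[of x y z] by (simp add: diag_coeff_def algebra_simps)
qed

text \<open>
  The upper limit \<open>max 1 (b - j)\<close> is also admissible: if \<open>j \<ge> b\<close>, the extra term \<open>i = 1\<close> has the
  binomial coefficient of a number smaller than \<open>a - 1\<close>.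
\<close>

lemma sum_alt_sum_pair_coeff:
  assumes "1 < a" "b \<le> N" "\<And>j. u j = b - j \<or> u j = max 1 (b - j)"
  shows "(\<Sum>i=1..N. D_q.alt_sum (pair_coeff i) (h i) a b) =
    (\<Sum>j=0..a. \<Sum>i=1..u j. (-1) ^ j * of_nat ((a + b - 1 - i - j) choose (a - 1)) * of_nat (a choose j)
       * (D_q ^^ j) (h i))"
proof -
  have inner: "(\<Sum>i=1..N. (-1) ^ j * of_nat (pair_coeff i a b j) * (D_q ^^ j) (h i)) =
      (\<Sum>i=1..u j. (-1) ^ j * of_nat ((a + b - 1 - i - j) choose (a - 1)) * of_nat (a choose j)
        * (D_q ^^ j) (h i))" (is "?l = ?r") for j
  proof -
    have "?l = (\<Sum>i=1..b-j. (-1) ^ j * of_nat (pair_coeff i a b j) * (D_q ^^ j) (h i))"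
      using assms(2) by (intro sum.mono_neutral_right) (auto simp: pair_coeff_def)
    also have "\<dots> = (\<Sum>i=1..b-j. (-1) ^ j * of_nat ((a + b - 1 - i - j) choose (a - 1))
        * of_nat (a choose j) * (D_q ^^ j) (h i))"
      using assms(1) by (intro sum.cong) (auto simp: pair_coeff_eq mult.assoc)
    also have "\<dots> = ?r"
      using assms(1) assms(3)[of j]
      by (intro sum.mono_neutral_left) (auto simp: max_def binomial_eq_0 split: if_splits)
    finally show ?thesis .
  qed
  show ?thesis
    unfolding D_q.alt_sum_def by (subst sum.swap) (simp only: inner atMost_atLeast0)
qed

theorem proposition3:
  fixes a b :: nat and f g :: tq_series
  assumes "1 < a" and "a \<le> b" and "f \<in> \<A>" and "g \<in> \<A>"
  shows "(D_q ^^ a) f * (D_q ^^ b) g =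
      (\<Sum>j=0..a. \<Sum>i=1..b-j. (-1) ^ j * of_nat ((a + b - 1 - i - j) choose (a - 1)) * of_nat (a choose j)
         * (D_q ^^ j) (f * (D_q ^^ i) g))
    + (\<Sum>j=0..b. \<Sum>i=1..max 1 (a-j). (-1) ^ j * of_nat ((a + b - 1 - i - j) choose (b - 1)) * of_nat (b choose j)
         * (D_q ^^ j) ((D_q ^^ i) f * g))
    + (\<Sum>j=1..a. (-1) ^ j * of_nat (trinomial (a + b - 1 - j) (j - 1) (a - j) (b - j))
         * (D_q ^^ j) (f * g))"
proof -
  have "1 < b" using assms by simp
  have diag: "D_q.alt_sum diag_coeff (f * g) a b =
      (\<Sum>j=1..a. (-1) ^ j * of_nat (trinomial (a + b - 1 - j) (j - 1) (a - j) (b - j))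
         * (D_q ^^ j) (f * g))"
  proof -
    have "D_q.alt_sum diag_coeff (f * g) a b =
        (\<Sum>j=1..a. (-1) ^ j * of_nat (diag_coeff a b j) * (D_q ^^ j) (f * g))"
      unfolding D_q.alt_sum_def using assms(1)
      by (intro sum.mono_neutral_right) (auto simp: diag_coeff_def)
    also have "\<dots> = (\<Sum>j=1..a. (-1) ^ j
        * of_nat (trinomial (a + b - 1 - j) (j - 1) (a - j) (b - j)) * (D_q ^^ j) (f * g))"
      using assms(2) by (intro sum.cong) (auto simp: diag_coeff_eq_trinomial)
    finally show ?thesis .
  qed
  have left: "(\<Sum>i=1..b. D_q.alt_sum (pair_coeff i) (f * (D_q ^^ i) g) a b) =
      (\<Sum>j=0..a. \<Sum>i=1..b-j. (-1) ^ j * of_nat ((a + b - 1 - i - j) choose (a - 1)) * of_nat (a choose j)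
         * (D_q ^^ j) (f * (D_q ^^ i) g))"
    using \<open>1 < a\<close> by (intro sum_alt_sum_pair_coeff) auto
  \<comment> \<open>Here \<open>a\<close> and \<open>b\<close> trade places, so
    \<open>a \<le> b\<close> is what makes \<open>b\<close> an admissible bound
    \<open>N\<close>.\<close>
  have "(\<Sum>i=1..b. D_q.alt_sum (pair_coeff i) ((D_q ^^ i) f * g) b a) =
      (\<Sum>j=0..b. \<Sum>i=1..max 1 (a-j). (-1) ^ j * of_nat ((b + a - 1 - i - j) choose (b - 1)) * of_nat (b choose j)
         * (D_q ^^ j) ((D_q ^^ i) f * g))"
    using \<open>1 < b\<close> \<open>a \<le> b\<close> by (intro sum_alt_sum_pair_coeff) auto
  note right = this[unfolded add.commute[of b a]]
  show ?thesis
    unfolding D_q.D_pow_mult_D_pow[OF \<open>a \<le> b\<close> order_refl] left right diag ..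
qed

end
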